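(* Let $N$ be a timelike ruled surface of type $N_-$ in $\mathbb{R}_1^3$ with timelike striction curve $\vec c$, and let $N^\beta$ be a $\beta$-transversal surface of $N$ whose striction curve $\vec c_\beta$ coincides with $\vec c$. Then $\vec c$ is an asymptotic line on $N$ if and only if $\beta$ is constant.
   Context: $\mathbb{R}_1^3$ is Minkowski 3-space with metric $\langle\cdot,\cdot\rangle=-dx_1^2+dx_2^2+dx_3^2$. A nonzero vector $\vec v$ is timelike if $\langle\vec v,\vec v\rangle<0$, null if $\langle\vec v,\vec v\rangle=0$, spacelike if $\langle\vec v,\vec v\rangle>0$. Setting. All functions are smooth on an open interval $I$. A timelike ruled surface of type $N_-$ with timelike striction curve is $\vec r(s,v)=\vec c(s)+v\vec q(s)$, with ruling direction $\vec q$ unit timelike, where $\vec c$ is its striction curve, a timelike curve parametrized by arc length $s$. It has a Frenet frame $\{\vec q,\vec h,\vec a\}$ of mutually orthogonal vectors, $\langle\vec q,\vec q\rangle=-1$, $\langle\vec h,\vec h\rangle=\langle\vec a,\vec a\rangle=1$ ($\vec h$ is the central normal, i.e. the surface normal along $\vec c$; $\vec a$ the central tangent), with $\vec q\,'=k_1\vec h$, $\vec h'=k_1\vec q+k_2\vec a$, $\vec a'=-k_2\vec h$ (prime is $d/ds$) for functions $k_1,k_2$. Standing assumption: the derivatives of the frame vectors are non-null and $N$ is non-cylindrical; in particular $k_1\neq0$ and $k_1^2\neq k_2^2$ everywhere. The unit tangent of $\vec c$ is $\vec c\,'=\vec t=\cosh\theta\,\vec q+\sinh\theta\,\vec a$ for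 a real function $\theta$ (the hyperbolic angle between $\vec t$ and $\vec q$). $\beta$-transversal surface. For a function $\beta:I\to\mathbb{R}$ with $\beta(s)\neq n\pi,\ (2n+1)\pi/2$ for all $s\in I$, $n\in\mathbb{Z}$, $N^\beta$ is the ruled surface $\vec r_\beta(s,v)=\vec c(s)+v\vec q_\beta(s)$ with $\vec q_\beta=\cos\beta\,\vec h+\sin\beta\,\vec a$; it is assumed that $\langle\vec q_\beta',\vec q_\beta'\rangle\ne0$ everywhere. Its striction curve is $\vec c_\beta=\vec c+v_\beta\vec q_\beta$ with $v_\beta=-\langle\vec c\,',\vec q_\beta'\rangle/\langle\vec q_\beta',\vec q_\beta'\rangle$; it coincides with $\vec c$ if $v_\beta=0$ on $I$. The curve $\vec c$ is an asymptotic line on $N$ if $\langle\vec h,\vec c\,''\rangle=0$ on $I$. *)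

theory Defs
  imports "HOL-Analysis.Analysis"
begin

text \<open>Minkowski 3-space: the vector space \<open>real^3\<close> with a form of signature \<open>(-,+,+)\<close>.\<close>

definition lorentz :: "real^3 \<Rightarrow> real^3 \<Rightarrow> real"  (\<open>\<langle>_,/ _\<rangle>\<close>)
  where "\<langle>x, y\<rangle> = - (x $ 1 * y $ 1) + x $ 2 * y $ 2 + x $ 3 * y $ 3"

text \<open>The zero vector has no causal character; in particular it is not null.\<close>

definition timelike :: "real^3 \<Rightarrow> bool"
  where "timelike x \<longleftrightarrow> x \<noteq> 0 \<and> \<langle>x, x\<rangle> < 0"

definition null :: "real^3 \<Rightarrow> bool"
  where "null x \<longleftrightarrow> x \<noteq> 0 \<and> \<langle>x, x\<rangle> = 0"

definition spacelike :: "real^3 \<Rightarrow> bool"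
  where "spacelike x \<longleftrightarrow> x \<noteq> 0 \<and> \<langle>x, x\<rangle> > 0"

text \<open>Derivatives of all orders exist on \<open>I\<close>; \<open>D n\<close> is the \<open>n\<close>-th derivative.
  As the derivatives are two-sided, this is meant for open \<open>I\<close>.\<close>

definition smooth_on :: "real set \<Rightarrow> (real \<Rightarrow> 'a::real_normed_vector) \<Rightarrow> bool"
  where "smooth_on I f \<longleftrightarrow>
    (\<exists>D :: nat \<Rightarrow> real \<Rightarrow> 'a. D 0 = f \<and>
      (\<forall>n. \<forall>s\<in>I. (D n has_vector_derivative D (Suc n) s) (at s)))"

abbreviation D1 :: "(real \<Rightarrow> 'a::real_normed_vector) \<Rightarrow> real \<Rightarrow> 'a"
  where "D1 f s \<equiv> vector_derivative f (at s)"

definition ruled_surface :: "(real \<Rightarrow> real^3) \<Rightarrow> (real \<Rightarrow> real^3) \<Rightarrow> real \<Rightarrow> real \<Rightarrow> real^3"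
  where "ruled_surface c q s v = c s + v *\<^sub>R q s"

definition partial_s :: "(real \<Rightarrow> real \<Rightarrow> real^3) \<Rightarrow> real \<Rightarrow> real \<Rightarrow> real^3"
  where "partial_s r s v = D1 (\<lambda>u. r u v) s"

definition partial_v :: "(real \<Rightarrow> real \<Rightarrow> real^3) \<Rightarrow> real \<Rightarrow> real \<Rightarrow> real^3"
  where "partial_v r s v = D1 (\<lambda>w. r s w) v"

definition tangent_space :: "(real \<Rightarrow> real \<Rightarrow> real^3) \<Rightarrow> real \<Rightarrow> real \<Rightarrow> (real^3) set"
  where "tangent_space r s v = span {partial_s r s v, partial_v r s v}"

text \<open>The induced metric is Lorentzian at every regular point: the tangent plane has an
  orthogonal basis consisting of a timelike and a spacelike vector. A ruled surface may have
  singular points, where no condition is imposed.\<close>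

definition timelike_surface :: "real set \<Rightarrow> (real \<Rightarrow> real \<Rightarrow> real^3) \<Rightarrow> bool"
  where "timelike_surface I r \<longleftrightarrow>
    (\<forall>s\<in>I. \<forall>v. dim (tangent_space r s v) = 2 \<longrightarrow>
      (\<exists>x\<in>tangent_space r s v. \<exists>y\<in>tangent_space r s v.
        timelike x \<and> spacelike y \<and> \<langle>x, y\<rangle> = 0))"

definition striction_param :: "(real \<Rightarrow> real^3) \<Rightarrow> (real \<Rightarrow> real^3) \<Rightarrow> real \<Rightarrow> real"
  where "striction_param c q s = - (\<langle>D1 c s, D1 q s\<rangle> / \<langle>D1 q s, D1 q s\<rangle>)"

definition striction_curve :: "(real \<Rightarrow> real^3) \<Rightarrow> (real \<Rightarrow> real^3) \<Rightarrow> real \<Rightarrow> real^3"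
  where "striction_curve c q s = c s + striction_param c q s *\<^sub>R q s"

text \<open>Here \<open>n\<close> is the normal of the surface along the curve \<open>c\<close>.\<close>

definition asymptotic_line :: "real set \<Rightarrow> (real \<Rightarrow> real^3) \<Rightarrow> (real \<Rightarrow> real^3) \<Rightarrow> bool"
  where "asymptotic_line I n c \<longleftrightarrow> (\<forall>s\<in>I. \<langle>n s, D1 (D1 c) s\<rangle> = 0)"

text \<open>A timelike ruled surface of type \<open>N\<^sub>-\<close> whose base curve \<open>c\<close> is its striction curve and is
  timelike, with Frenet frame \<open>(q, h, a)\<close>, curvatures \<open>k1\<close>, \<open>k2\<close> and hyperbolic angle \<open>\<theta>\<close>.
  The assumptions \<open>noncylindrical\<close> and \<open>nonnull\<close> amount to \<open>k1 \<noteq> 0\<close> and \<open>k1\<^sup>2 \<noteq> k2\<^sup>2\<close>;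
  \<open>k2\<close> may vanish, since the zero vector is not null.\<close>

locale ruled_surface_N_minus =
  fixes I :: "real set"
    and c q h a :: "real \<Rightarrow> real^3"
    and k1 k2 \<theta> :: "real \<Rightarrow> real"
  assumes interval: "open I" "is_interval I" "I \<noteq> {}"
    and smooth_vectors: "smooth_on I c" "smooth_on I q" "smooth_on I h" "smooth_on I a"
    and smooth_scalars: "smooth_on I k1" "smooth_on I k2" "smooth_on I \<theta>"
    and timelike_surface: "timelike_surface I (ruled_surface c q)"
    and striction: "\<And>s. s \<in> I \<Longrightarrow> striction_curve c q s = c s"
    and timelike_curve: "\<And>s. s \<in> I \<Longrightarrow> timelike (D1 c s)"
    and arc_length: "\<And>s. s \<in> I \<Longrightarrow> \<langle>D1 c s, D1 c s\<rangle> = -1"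
    and unit: "\<And>s. s \<in> I \<Longrightarrow> \<langle>q s, q s\<rangle> = -1"
              "\<And>s. s \<in> I \<Longrightarrow> \<langle>h s, h s\<rangle> = 1"
              "\<And>s. s \<in> I \<Longrightarrow> \<langle>a s, a s\<rangle> = 1"
    and orthogonal: "\<And>s. s \<in> I \<Longrightarrow> \<langle>q s, h s\<rangle> = 0"
                    "\<And>s. s \<in> I \<Longrightarrow> \<langle>q s, a s\<rangle> = 0"
                    "\<And>s. s \<in> I \<Longrightarrow> \<langle>h s, a s\<rangle> = 0"
    and normal: "\<And>s x. s \<in> I \<Longrightarrow> x \<in> tangent_space (ruled_surface c q) s 0 \<Longrightarrow> \<langle>h s, x\<rangle> = 0"
    and frenet: "\<And>s. s \<in> I \<Longrightarrow> D1 q s = k1 s *\<^sub>R h s"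
                "\<And>s. s \<in> I \<Longrightarrow> D1 h s = k1 s *\<^sub>R q s + k2 s *\<^sub>R a s"
                "\<And>s. s \<in> I \<Longrightarrow> D1 a s = - k2 s *\<^sub>R h s"
    and noncylindrical: "\<And>s. s \<in> I \<Longrightarrow> D1 q s \<noteq> 0"
    and nonnull: "\<And>s. s \<in> I \<Longrightarrow> \<not> null (D1 q s)"
                 "\<And>s. s \<in> I \<Longrightarrow> \<not> null (D1 h s)"
                 "\<And>s. s \<in> I \<Longrightarrow> \<not> null (D1 a s)"
    and tangent: "\<And>s. s \<in> I \<Longrightarrow> D1 c s = cosh (\<theta> s) *\<^sub>R q s + sinh (\<theta> s) *\<^sub>R a s"

definition transversal_ruling ::
    "(real \<Rightarrow> real^3) \<Rightarrow> (real \<Rightarrow> real^3) \<Rightarrow> (real \<Rightarrow> real) \<Rightarrow> real \<Rightarrow> real^3"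
  where "transversal_ruling h a \<beta> s = cos (\<beta> s) *\<^sub>R h s + sin (\<beta> s) *\<^sub>R a s"

text \<open>The \<open>\<beta>\<close>-transversal surface itself is \<open>ruled_surface c (transversal_ruling h a \<beta>)\<close>.\<close>

locale transversal_surface = ruled_surface_N_minus +
  fixes \<beta> :: "real \<Rightarrow> real"
  assumes smooth_angle: "smooth_on I \<beta>"
    and angle: "\<And>s n. s \<in> I \<Longrightarrow> \<beta> s \<noteq> of_int n * pi"
               "\<And>s n. s \<in> I \<Longrightarrow> \<beta> s \<noteq> (2 * of_int n + 1) * pi / 2"
    and nonnull_ruling: "\<And>s. s \<in> I \<Longrightarrow>
          \<langle>D1 (transversal_ruling h a \<beta>) s, D1 (transversal_ruling h a \<beta>) s\<rangle> \<noteq> 0"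

end

(* Since cos beta does not vanish, v_beta = 0 amounts to
     k1 cosh theta = (beta' + k2) sinh theta,
   while the normal component of c'' is k1 cosh theta - k2 sinh theta. Hence <h, c''> = beta' sinh theta,
   and sinh theta cannot vanish because k1 cosh theta does not. *)

theory Submission imports Defs begin

lemma lorentz_sym: "\<langle>x, y\<rangle> = \<langle>y, x\<rangle>"
  by (simp add: lorentz_def mult.commute)

lemma lorentz_linear:
  "\<langle>x + y, z\<rangle> = \<langle>x, z\<rangle> + \<langle>y, z\<rangle>"
  "\<langle>z, x + y\<rangle> = \<langle>z, x\<rangle> + \<langle>z, y\<rangle>"
  "\<langle>r *\<^sub>R x, y\<rangle> = r * \<langle>x, y\<rangle>"
  "\<langle>x, r *\<^sub>R y\<rangle> = r * \<langle>x, y\<rangle>"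
  by (simp_all add: lorentz_def algebra_simps)

lemma smooth_on_has_vector_derivative:
  assumes "smooth_on I f" and "s \<in> I"
  shows "(f has_vector_derivative D1 f s) (at s)"
  using assms unfolding smooth_on_def by (metis vector_derivative_at)

text \<open>Openness lets the two-sided derivative at a point see only values on \<open>I\<close>;
  connectedness of the interval makes one constant serve all of it.\<close>

lemma constant_on_iff_D1_eq_0:
  fixes f :: "real \<Rightarrow> real"
  assumes "open I" "is_interval I" and smooth: "smooth_on I f"
  shows "f constant_on I \<longleftrightarrow> (\<forall>s\<in>I. D1 f s = 0)"
proof
  assume "f constant_on I"
  then obtain k where k: "\<And>s. s \<in> I \<Longrightarrow> f s = k"
    by (auto simp: constant_on_def)
  show "\<forall>s\<in>I. D1 f s = 0"
  proof
    fix s assume "s \<in> I"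
    have "(f has_vector_derivative 0) (at s)"
      by (rule has_vector_derivative_transform_within_open[OF has_vector_derivative_const \<open>open I\<close> \<open>s \<in> I\<close>])
        (simp add: k)
    then show "D1 f s = 0" by (rule vector_derivative_at)
  qed
next
  assume zero: "\<forall>s\<in>I. D1 f s = 0"
  have "(f has_vector_derivative 0) (at s within I)" if "s \<in> I" for s
    using smooth_on_has_vector_derivative[OF smooth that] zero that
    by (auto intro: has_vector_derivative_at_within)
  then obtain k where "\<And>s. s \<in> I \<Longrightarrow> f s = k"
    using has_vector_derivative_zero_constant[of I f] \<open>is_interval I\<close>
    by (metis is_interval_convex)
  then show "f constant_on I" by (auto simp: constant_on_def)
qed

context ruled_surface_N_minus
begin

lemma k1_nonzero: "s \<in> I \<Longrightarrow> k1 s \<noteq> 0"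
  using noncylindrical frenet(1) by fastforce

text \<open>Both argument orders of each orthogonality relation are listed, so products of frame
  vectors simplify without a symmetry step.\<close>

lemmas frame = unit orthogonal orthogonal[unfolded lorentz_sym[of "q _"] lorentz_sym[of "h _" "a _"]]

text \<open>Differentiating \<open>tangent\<close>, the terms with \<theta>' lie along
  \<open>q\<close> and \<open>a\<close>, hence are orthogonal to \<open>h\<close>; only q' and a',
  both multiples of \<open>h\<close>, contribute.\<close>

lemma lorentz_normal_D1_D1:
  assumes s: "s \<in> I"
  shows "\<langle>h s, D1 (D1 c) s\<rangle> = k1 s * cosh (\<theta> s) - k2 s * sinh (\<theta> s)"
proof -
  note d = smooth_on_has_vector_derivative[OF _ s]
  have \<theta>: "(\<theta> has_field_derivative D1 \<theta> s) (at s)"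
    using d[OF smooth_scalars(3)] by (simp add: has_real_derivative_iff_has_vector_derivative)
  have "((\<lambda>u. cosh (\<theta> u) *\<^sub>R q u + sinh (\<theta> u) *\<^sub>R a u) has_vector_derivative
      (cosh (\<theta> s) *\<^sub>R D1 q s + (sinh (\<theta> s) * D1 \<theta> s) *\<^sub>R q s) +
      (sinh (\<theta> s) *\<^sub>R D1 a s + (cosh (\<theta> s) * D1 \<theta> s) *\<^sub>R a s)) (at s)"
    by (intro has_vector_derivative_add has_vector_derivative_scaleR d smooth_vectors)
      (auto intro!: derivative_eq_intros \<theta>)
  then have "(D1 c has_vector_derivative
      (cosh (\<theta> s) *\<^sub>R D1 q s + (sinh (\<theta> s) * D1 \<theta> s) *\<^sub>R q s) +
      (sinh (\<theta> s) *\<^sub>R D1 a s + (cosh (\<theta> s) * D1 \<theta> s) *\<^sub>R a s)) (at s)"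
    \<comment> \<open>The formula for c' is known only on \<open>I\<close>, so passing to its
      derivative needs a neighbourhood of \<open>s\<close> inside \<open>I\<close>.\<close>
    by (rule has_vector_derivative_transform_within_open[OF _ interval(1) s]) (simp add: tangent)
  then show ?thesis
    \<comment> \<open>\<open>- k2 s *\<^sub>R h s\<close> must stay a scalar multiple:
      \<open>lorentz_linear\<close> has no rule for a negated vector.\<close>
    by (simp add: vector_derivative_at lorentz_linear frenet[OF s] frame[OF s] mult.commute
        del: scaleR_minus_left)
qed

end

context transversal_surface
begin

text \<open>The ruling turns by \<beta> in the plane of \<open>h\<close> and \<open>a\<close>, and
  that pair itself turns at rate \<open>k2\<close>; the two rates add up, while the component along
  \<open>q\<close> comes from h' alone.\<close>

lemma D1_transversal_ruling:
  assumes s: "s \<in> I"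
  shows "D1 (transversal_ruling h a \<beta>) s =
    (k1 s * cos (\<beta> s)) *\<^sub>R q s + (- (D1 \<beta> s + k2 s) * sin (\<beta> s)) *\<^sub>R h s +
    ((D1 \<beta> s + k2 s) * cos (\<beta> s)) *\<^sub>R a s"
proof -
  note d = smooth_on_has_vector_derivative[OF _ s]
  have \<beta>: "(\<beta> has_field_derivative D1 \<beta> s) (at s)"
    using d[OF smooth_angle] by (simp add: has_real_derivative_iff_has_vector_derivative)
  have "((\<lambda>u. cos (\<beta> u) *\<^sub>R h u + sin (\<beta> u) *\<^sub>R a u) has_vector_derivative
      (cos (\<beta> s) *\<^sub>R D1 h s + (- sin (\<beta> s) * D1 \<beta> s) *\<^sub>R h s) +
      (sin (\<beta> s) *\<^sub>R D1 a s + (cos (\<beta> s) * D1 \<beta> s) *\<^sub>R a s)) (at s)"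
    by (intro has_vector_derivative_add has_vector_derivative_scaleR d smooth_vectors)
      (auto intro!: derivative_eq_intros \<beta>)
  then show ?thesis
    unfolding transversal_ruling_def[abs_def]
    by (simp add: vector_derivative_at frenet[OF s] algebra_simps)
qed

lemma cos_angle_nonzero: "s \<in> I \<Longrightarrow> cos (\<beta> s) \<noteq> 0"
proof
  assume s: "s \<in> I" and "cos (\<beta> s) = 0"
  then obtain m where "odd m" and m: "\<beta> s = of_int m * (pi / 2)"
    by (auto simp: cos_zero_iff_int)
  then obtain n where "m = 2 * n + 1" by (auto elim: oddE)
  then show False using angle(2)[OF s, of n] m by simp
qed

text \<open>The component along \<open>h\<close> is cos \<beta>. This turns coincidence of the
  striction curves, a vanishing multiple of the ruling, into a vanishing striction
  parameter.\<close>

lemma transversal_ruling_nonzero: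
  assumes "s \<in> I"
  shows "transversal_ruling h a \<beta> s \<noteq> 0"
proof
  assume "transversal_ruling h a \<beta> s = 0"
  then have "\<langle>h s, transversal_ruling h a \<beta> s\<rangle> = 0" by (simp add: lorentz_def)
  then show False
    using cos_angle_nonzero[OF assms]
    by (simp add: transversal_ruling_def lorentz_linear frame[OF assms])
qed

lemma striction_condition:
  assumes s: "s \<in> I" and striction: "striction_curve c (transversal_ruling h a \<beta>) s = c s"
  shows "k1 s * cosh (\<theta> s) = (D1 \<beta> s + k2 s) * sinh (\<theta> s)"
proof -
  have "\<langle>D1 c s, D1 (transversal_ruling h a \<beta>) s\<rangle> = 0"
    \<comment> \<open>The parameter is a quotient with nonzero denominator by
      \<open>nonnull_ruling\<close>, so its numerator vanishes.\<close>
    using striction transversal_ruling_nonzero[OF s] nonnull_ruling[OF s]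
    by (simp add: striction_curve_def striction_param_def)
  \<comment> \<open>c' has no component along \<open>h\<close>, so the sin \<beta> term drops out
    and cos \<beta> is a common factor; the minus sign stems from \<open>q\<close> being
    timelike.\<close>
  then have "cos (\<beta> s) * ((D1 \<beta> s + k2 s) * sinh (\<theta> s) - k1 s * cosh (\<theta> s)) = 0"
    unfolding D1_transversal_ruling[OF s] tangent[OF s] lorentz_linear
    by (simp add: frame[OF s] algebra_simps)
  then show ?thesis using cos_angle_nonzero[OF s] by simp
qed

end

theorem theorem5p2:
  fixes I :: "real set"
    and c q h a :: "real \<Rightarrow> real^3"
    and k1 k2 \<theta> \<beta> :: "real \<Rightarrow> real"
  assumes "ruled_surface_N_minus I c q h a k1 k2 \<theta>"
    and "transversal_surface I c q h a k1 k2 \<theta> \<beta>"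
    and "\<And>s. s \<in> I \<Longrightarrow> striction_curve c (transversal_ruling h a \<beta>) s = c s"
  shows "asymptotic_line I h c \<longleftrightarrow> \<beta> constant_on I"
proof -
  interpret transversal_surface I c q h a k1 k2 \<theta> \<beta> by fact
  \<comment> \<open>The equivalence already holds at each point of \<open>I\<close>; the theorem
    follows by quantifying over \<open>s\<close>.\<close>
  have "\<langle>h s, D1 (D1 c) s\<rangle> = 0 \<longleftrightarrow> D1 \<beta> s = 0" if s: "s \<in> I" for s
  proof -
    note str = striction_condition[OF s assms(3)[OF s]]
    have "sinh (\<theta> s) \<noteq> 0" using str k1_nonzero[OF s] by auto
    moreover have "\<langle>h s, D1 (D1 c) s\<rangle> = D1 \<beta> s * sinh (\<theta> s)"
      using str by (simp add: lorentz_normal_D1_D1[OF s] algebra_simps)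
    ultimately show ?thesis by simp
  qed
  then show ?thesis
    by (simp add: asymptotic_line_def constant_on_iff_D1_eq_0[OF interval(1,2) smooth_angle])
qed

end
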